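(* For each $C\in\mathcal{A}$ with $\mu(C)<\infty$, we have $$\lim_{n\to\infty}\lambda\big(T^{-n}(C)\big)=0,$$ where $T$ is the Farey map on $[0,1]$ and $\lambda$ is Lebesgue measure.
   Context: The Farey map $T:[0,1]\to[0,1]$ is $T(x):=x/(1-x)$ for $x\in[0,1/2]$ and $T(x):=(1-x)/x$ for $x\in(1/2,1]$. $\mathcal{A}$ is the Borel $\sigma$-algebra of $[0,1]$, and $\mu$ is the infinite $\sigma$-finite $T$-invariant measure on $[0,1]$, absolutely continuous with respect to Lebesgue measure $\lambda$, given by $d\lambda=\phi_0\,d\mu$ with $\phi_0(x):=x$ (i.e. $d\mu(x)=x^{-1}\,d\lambda(x)$). *)

theory Defs
  imports "HOL-Analysis.Analysis"
begin

text \<open>The Farey map is only meaningful on \<open>{0..1}\<close>; as a HOL function it also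
  takes values outside, so preimages have to be intersected with the unit interval.\<close>

definition farey :: "real \<Rightarrow> real" where
  "farey x = (if x \<le> 1/2 then x / (1 - x) else (1 - x) / x)"

definition unit_lebesgue :: "real measure" where
  "unit_lebesgue = restrict_space lborel {0..1}"

text \<open>The density is \<open>\<infinity>\<close> at the Lebesgue-null point \<open>0\<close>. The relation
  \<open>d\<lambda> = \<phi>\<^sub>0 d\<mu>\<close> with \<open>\<phi>\<^sub>0(x) = x\<close> is lemma \<open>unit_lebesgue_eq_density\<close>.\<close>

definition farey_measure :: "real measure" where
  "farey_measure = density unit_lebesgue (\<lambda>x. inverse (ennreal x))"

lemma farey_maps_unit: "x \<in> {0..1} \<Longrightarrow> farey x \<in> {0..1}"
  by (auto simp: farey_def field_simps)

lemma farey_borel_measurable [measurable]: "farey \<in> borel_measurable borel"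
  unfolding farey_def by measurable

lemma farey_measurable_unit:
  "farey \<in> restrict_space borel {0..1} \<rightarrow>\<^sub>M restrict_space borel {0..1}"
  by (intro measurable_restrict_space3 farey_borel_measurable)
     (use farey_maps_unit in auto)

lemma sets_farey_measure: "sets farey_measure = sets (restrict_space borel {0..1})"
  by (simp add: farey_measure_def unit_lebesgue_def sets_restrict_space)

lemma unit_lebesgue_eq_density: "unit_lebesgue = density farey_measure (\<lambda>x. ennreal x)"
proof -
  have m: "(\<lambda>x. ennreal x) \<in> borel_measurable unit_lebesgue"
          "(\<lambda>x. inverse (ennreal x)) \<in> borel_measurable unit_lebesgue"
    unfolding unit_lebesgue_def by (intro measurable_restrict_space1; measurable)+
  have nz: "AE x in unit_lebesgue. inverse (ennreal x) * ennreal x = 1"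
    unfolding unit_lebesgue_def
  proof (subst AE_restrict_space_iff)
    show "{0..1} \<inter> space lborel \<in> sets (lborel :: real measure)" by simp
    have "AE x in lborel. x \<noteq> (0::real)" by (rule AE_lborel_singleton)
    then show "AE x in lborel. x \<in> {0..1::real} \<longrightarrow> inverse (ennreal x) * ennreal x = 1"
      by eventually_elim
         (auto simp: inverse_ennreal ennreal_mult' [symmetric])
  qed
  have "density farey_measure (\<lambda>x. ennreal x)
      = density unit_lebesgue (\<lambda>x. inverse (ennreal x) * ennreal x)"
    unfolding farey_measure_def using m by (simp add: density_density_eq)
  also have "\<dots> = density unit_lebesgue (\<lambda>x. 1)"
    using m nz by (intro density_cong) auto
  finally show ?thesis by (simp add: density_1)
qed

end

theory Submission
  imports Defs
begin

text \<open>
  Write \<open>T\<close> for the Farey map, \<open>\<lambda>\<close> for Lebesgue measure on the unit interval and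
  \<open>\<mu>\<close> for the invariant measure \<open>dx / x\<close>. Since \<open>d\<lambda> = x d\<mu>\<close>, the measure
  \<open>\<lambda>(T\<^sup>-\<^sup>n C)\<close> equals the \<open>\<mu>\<close>-integral over \<open>C\<close> of \<open>g\<^sub>n\<close>, where \<open>g\<^sub>n\<close> is the \<open>n\<close>-th
  iterate of the identity function under the transfer operator of \<open>T\<close> with respect
  to \<open>\<mu>\<close> (\<open>emeasure_vimage_farey_iterate\<close>). As \<open>\<mu>(C)\<close> is finite, it suffices that
  \<open>g\<^sub>n\<close> tends to \<open>0\<close> uniformly.

  The transfer operator averages: its value at \<open>x\<close> is the convex combination
  \<open>(1 - u) g(u) + u g(1 - u)\<close> of the values at the two \<open>T\<close>-preimages \<open>u = x / (1 + x)\<close>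
  and \<open>1 - u\<close> of \<open>x\<close>. It maps nonnegative, increasing, concave functions to functions
  of the same kind (\<open>concave_profile_farey_dual\<close>), so each \<open>g\<^sub>n\<close> is increasing and its
  maximum is \<open>g\<^sub>n(1)\<close>. This maximum decreases with \<open>n\<close>, to a limit \<open>a\<close> say.

  The limit is \<open>0\<close>. The averaging at the point \<open>1/k\<close> involves the values at
  \<open>1/(k+1)\<close> and \<open>k/(k+1)\<close>. If the average tends to the limit \<open>a\<close> of the maxima, then
  so does the value at \<open>1/(k+1)\<close>; by induction \<open>g\<^sub>n(1/k)\<close> tends to \<open>a\<close> for every \<open>k\<close>
  (\<open>farey_iterate_tendsto_at_unit_fraction\<close>). But the \<open>\<mu>\<close>-integral of \<open>g\<^sub>n\<close> is \<open>1\<close>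
  for all \<open>n\<close>, while the interval from \<open>1/k\<close> to \<open>1\<close> has \<open>\<mu>\<close>-measure \<open>ln k\<close> and
  \<open>g\<^sub>n\<close> is at least \<open>g\<^sub>n(1/k)\<close> on it. Hence \<open>a ln k \<le> 1\<close> for all \<open>k\<close>, which forces
  \<open>a = 0\<close>. This is where the infinite mass of \<open>\<mu>\<close> near \<open>0\<close> enters.
\<close>

section \<open>The transfer operator of the Farey map for the invariant measure\<close>

text \<open>
  The transfer operator with respect to \<open>dx / x\<close>: the arguments of \<open>g\<close> are the two
  preimages of \<open>x\<close>. Each weight is the derivative \<open>1 / (1 + x)\<^sup>2\<close> of the inverse branch
  (up to sign), times the density at the preimage, divided by the density at \<open>x\<close>.
\<close>
definition farey_dual :: "(real \<Rightarrow> real) \<Rightarrow> real \<Rightarrow> real" where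
  "farey_dual g x = 1 / (1 + x) * g (x / (1 + x)) + x / (1 + x) * g (1 / (1 + x))"

lemma farey_dual_measurable [measurable]:
  assumes [measurable]: "g \<in> borel_measurable borel"
  shows "farey_dual g \<in> borel_measurable borel"
  unfolding farey_dual_def [abs_def] by measurable

lemma farey_dual_nonneg:
  assumes "\<And>x. x \<in> {0..1} \<Longrightarrow> 0 \<le> g x" and "x \<in> {0..1}"
  shows "0 \<le> farey_dual g x"
  using assms unfolding farey_dual_def by (auto intro!: add_nonneg_nonneg mult_nonneg_nonneg)

lemma nn_integral_farey_measure:
  assumes [measurable]: "F \<in> borel_measurable borel"
  shows "(\<integral>\<^sup>+x. F x \<partial>farey_measure) = (\<integral>\<^sup>+x. F x * ennreal (1 / x) * indicator {0..1} x \<partial>lborel)"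
proof -
  have "(\<integral>\<^sup>+x. F x \<partial>farey_measure) = (\<integral>\<^sup>+x. inverse (ennreal x) * F x \<partial>unit_lebesgue)"
    unfolding farey_measure_def unit_lebesgue_def
    by (intro nn_integral_density measurable_restrict_space1) auto
  also have "\<dots> = (\<integral>\<^sup>+x. inverse (ennreal x) * F x * indicator {0..1} x \<partial>lborel)"
    unfolding unit_lebesgue_def by (intro nn_integral_restrict_space) auto
  also have "\<dots> = (\<integral>\<^sup>+x. F x * ennreal (1 / x) * indicator {0..1} x \<partial>lborel)"
  proof (intro nn_integral_cong_AE)
    have "AE x in lborel. x \<noteq> (0::real)" by (rule AE_lborel_singleton)
    then show "AE x in lborel. inverse (ennreal x) * F x * indicator {0..1} x =
        F x * ennreal (1 / x) * indicator {0..1} x"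
      by eventually_elim
        (auto simp: inverse_ennreal inverse_eq_divide mult.commute split: split_indicator)
  qed
  finally show ?thesis .
qed

lemma nn_integral_left_branch:
  fixes F :: "real \<Rightarrow> ennreal"
  assumes [measurable]: "F \<in> borel_measurable borel"
  shows "(\<integral>\<^sup>+y. F y * indicator {0..1/2} y \<partial>lborel)
    = (\<integral>\<^sup>+x. F (x / (1 + x)) * ennreal (1 / (1 + x)\<^sup>2) * indicator {0..1} x \<partial>lborel)"
proof -
  have "((\<lambda>x. x / (1 + x)) has_real_derivative 1 / (1 + x)\<^sup>2) (at x)" if "x \<in> {0..1}" for x :: real
    using that by (auto intro!: derivative_eq_intros simp: power2_eq_square divide_simps)
  moreover have "continuous_on {0..1} (\<lambda>x::real. 1 / (1 + x)\<^sup>2)"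
    by (intro continuous_intros) auto
  ultimately show ?thesis
    using nn_integral_substitution_aux[of F 0 1 "\<lambda>x. x / (1 + x)" "\<lambda>x. 1 / (1 + x)\<^sup>2"]
    by simp
qed

text \<open>
  The inverse branch \<open>1 / (1 + x)\<close> is decreasing, whereas the substitution rule asks
  for a nonnegative derivative. Hence the rule is applied to \<open>1 / (2 - t)\<close>, and
  \<open>t = 1 - x\<close> is substituted afterwards.
\<close>
lemma nn_integral_right_branch:
  fixes F :: "real \<Rightarrow> ennreal"
  assumes [measurable]: "F \<in> borel_measurable borel"
  shows "(\<integral>\<^sup>+y. F y * indicator {1/2..1} y \<partial>lborel)
    = (\<integral>\<^sup>+x. F (1 / (1 + x)) * ennreal (1 / (1 + x)\<^sup>2) * indicator {0..1} x \<partial>lborel)"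
proof -
  have "((\<lambda>t. 1 / (2 - t)) has_real_derivative 1 / (2 - t)\<^sup>2) (at t)" if "t \<in> {0..1}" for t :: real
    using that by (auto intro!: derivative_eq_intros simp: power2_eq_square divide_simps)
  moreover have "continuous_on {0..1} (\<lambda>t::real. 1 / (2 - t)\<^sup>2)"
    by (intro continuous_intros) auto
  ultimately have "(\<integral>\<^sup>+y. F y * indicator {1/2..1} y \<partial>lborel)
      = (\<integral>\<^sup>+t. F (1 / (2 - t)) * ennreal (1 / (2 - t)\<^sup>2) * indicator {0..1} t \<partial>lborel)"
    using nn_integral_substitution_aux[of F 0 1 "\<lambda>t. 1 / (2 - t)" "\<lambda>t. 1 / (2 - t)\<^sup>2"]
    by simp
  also have "\<dots> = (\<integral>\<^sup>+x. F (1 / (2 - (1 + (-1) * x))) * ennreal (1 / (2 - (1 + (-1) * x))\<^sup>2)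
      * indicator {0..1} (1 + (-1) * x) \<partial>lborel)"
    by (subst nn_integral_real_affine[where c = "-1" and t = 1]) auto
  also have "\<dots> = (\<integral>\<^sup>+x. F (1 / (1 + x)) * ennreal (1 / (1 + x)\<^sup>2) * indicator {0..1} x \<partial>lborel)"
    by (intro nn_integral_cong) (auto split: split_indicator)
  finally show ?thesis .
qed

lemma farey_left_branch: "x \<in> {0..1} \<Longrightarrow> farey (x / (1 + x)) = x"
  by (auto simp: farey_def divide_simps)

lemma farey_right_branch: "x \<in> {0..1} \<Longrightarrow> farey (1 / (1 + x)) = x"
  by (auto simp: farey_def divide_simps)

text \<open>
  The duality that defines the transfer operator. The integral is split over the
  domains of the two branches of the Farey map, and each part is transported to the
  full unit interval by the inverse branch.
\<close>
lemma nn_integral_farey_dual: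
  fixes f :: "real \<Rightarrow> ennreal"
  assumes [measurable]: "f \<in> borel_measurable borel" "g \<in> borel_measurable borel"
    and nonneg: "\<And>x. x \<in> {0..1} \<Longrightarrow> 0 \<le> g x"
  shows "(\<integral>\<^sup>+x. f (farey x) * ennreal (g x) \<partial>farey_measure)
    = (\<integral>\<^sup>+x. f x * ennreal (farey_dual g x) \<partial>farey_measure)"
proof -
  define F where "F y = f (farey y) * ennreal (g y) * ennreal (1 / y)" for y
  have [measurable]: "F \<in> borel_measurable borel"
    unfolding F_def by measurable
  have "(\<integral>\<^sup>+x. f (farey x) * ennreal (g x) \<partial>farey_measure)
      = (\<integral>\<^sup>+y. F y * indicator {0..1} y \<partial>lborel)"
    by (subst nn_integral_farey_measure) (auto simp: F_def)
  also have "\<dots> = (\<integral>\<^sup>+y. F y * indicator {0..1/2} y + F y * indicator {1/2..1} y \<partial>lborel)"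
  proof (intro nn_integral_cong_AE)
    have "AE x in lborel. x \<noteq> (1/2::real)" by (rule AE_lborel_singleton)
    then show "AE y in lborel. F y * indicator {0..1} y =
        F y * indicator {0..1/2} y + F y * indicator {1/2..1} y"
      by eventually_elim (auto split: split_indicator)
  qed
  also have "\<dots> = (\<integral>\<^sup>+x. F (x / (1 + x)) * ennreal (1 / (1 + x)\<^sup>2) * indicator {0..1} x
      + F (1 / (1 + x)) * ennreal (1 / (1 + x)\<^sup>2) * indicator {0..1} x \<partial>lborel)"
    by (simp add: nn_integral_add nn_integral_left_branch nn_integral_right_branch)
  also have "\<dots> = (\<integral>\<^sup>+x. f x * ennreal (farey_dual g x) * ennreal (1 / x) * indicator {0..1} x \<partial>lborel)"
  proof (rule nn_integral_cong_AE, rule AE_mp[OF AE_lborel_singleton[of "0::real"]],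
      rule AE_I2, rule impI)
    (* At 0 the integrands may differ: 1 / 0 = 0 makes the right-hand side vanish, whereas
       the second branch contributes f 0 * g 1 on the left. *)
    fix x :: real
    assume "x \<noteq> 0"
    show "F (x / (1 + x)) * ennreal (1 / (1 + x)\<^sup>2) * indicator {0..1} x
      + F (1 / (1 + x)) * ennreal (1 / (1 + x)\<^sup>2) * indicator {0..1} x
      = f x * ennreal (farey_dual g x) * ennreal (1 / x) * indicator {0..1} x"
    proof (cases "x \<in> {0..1}")
      case True
      with \<open>x \<noteq> 0\<close> have x: "0 < x" "x \<le> 1" by auto
      let ?u = "x / (1 + x)" and ?v = "1 / (1 + x)"
      have uv: "?u \<in> {0..1}" "?v \<in> {0..1}" using x by auto
      have branch: "F y * ennreal w = f (farey y) * ennreal (g y * (1 / y) * w)"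
        if "y \<in> {0..1}" "0 \<le> w" for y w :: real
        using that nonneg[OF that(1)]
        by (subst ennreal_mult, simp, simp, subst ennreal_mult) (simp_all add: F_def mult.assoc)
      have left: "F ?u * ennreal (1 / (1 + x)\<^sup>2) = f x * ennreal (g ?u * (1 / ?u) * (1 / (1 + x)\<^sup>2))"
        using branch[OF uv(1), of "1 / (1 + x)\<^sup>2"] farey_left_branch[OF True] by (simp only:) simp
      have right: "F ?v * ennreal (1 / (1 + x)\<^sup>2) = f x * ennreal (g ?v * (1 / ?v) * (1 / (1 + x)\<^sup>2))"
        using branch[OF uv(2), of "1 / (1 + x)\<^sup>2"] farey_right_branch[OF True] by (simp only:) simp
      have "F ?u * ennreal (1 / (1 + x)\<^sup>2) + F ?v * ennreal (1 / (1 + x)\<^sup>2)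
          = f x * ennreal (g ?u * (1 / ?u) * (1 / (1 + x)\<^sup>2) + g ?v * (1 / ?v) * (1 / (1 + x)\<^sup>2))"
        unfolding left right distrib_left[symmetric]
        by (subst ennreal_plus[symmetric])
          (use x nonneg[OF uv(1)] nonneg[OF uv(2)] in auto)
      also have "g ?u * (1 / ?u) * (1 / (1 + x)\<^sup>2) + g ?v * (1 / ?v) * (1 / (1 + x)\<^sup>2)
          = farey_dual g x * (1 / x)"
        using x by (simp add: farey_dual_def power2_eq_square divide_simps)
      also have "f x * ennreal (farey_dual g x * (1 / x)) = f x * ennreal (farey_dual g x) * ennreal (1 / x)"
        using x farey_dual_nonneg[where g = g, OF nonneg True]
        by (subst ennreal_mult) (simp_all add: mult.assoc)
      finally show ?thesis using True by simp
    qed auto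
  qed
  also have "\<dots> = (\<integral>\<^sup>+x. f x * ennreal (farey_dual g x) \<partial>farey_measure)"
    by (subst nn_integral_farey_measure) auto
  finally show ?thesis .
qed

text \<open>
  The starting function is the density of Lebesgue measure with respect to the
  invariant measure, so the iterates are the densities, again with respect to the
  invariant measure, of the push-forwards of
  Lebesgue measure under the iterated Farey map.
\<close>
abbreviation farey_iterate :: "nat \<Rightarrow> real \<Rightarrow> real" where
  "farey_iterate n \<equiv> (farey_dual ^^ n) (\<lambda>x. x)"

lemma farey_iterate_measurable [measurable]: "farey_iterate n \<in> borel_measurable borel"
  by (induction n) auto

lemma farey_iterate_nonneg: "x \<in> {0..1} \<Longrightarrow> 0 \<le> farey_iterate n x"
proof (induction n arbitrary: x)
  case (Suc n)
  then show ?case by (auto intro: farey_dual_nonneg)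
qed auto

lemma nn_integral_farey_iterate:
  fixes f :: "real \<Rightarrow> ennreal"
  assumes "f \<in> borel_measurable borel"
  shows "(\<integral>\<^sup>+x. f ((farey ^^ n) x) * ennreal x \<partial>farey_measure)
    = (\<integral>\<^sup>+x. f x * ennreal (farey_iterate n x) \<partial>farey_measure)"
  using assms
proof (induction n arbitrary: f)
  case (Suc n)
  note [measurable] = Suc.prems
  have "(\<integral>\<^sup>+x. f ((farey ^^ Suc n) x) * ennreal x \<partial>farey_measure)
      = (\<integral>\<^sup>+x. f (farey x) * ennreal (farey_iterate n x) \<partial>farey_measure)"
    using Suc.IH[of "\<lambda>x. f (farey x)"] by simp
  also have "\<dots> = (\<integral>\<^sup>+x. f x * ennreal (farey_iterate (Suc n) x) \<partial>farey_measure)"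
    using nn_integral_farey_dual[of f "farey_iterate n"] farey_iterate_nonneg by simp
  finally show ?case .
qed simp

lemma emeasure_vimage_farey_iterate:
  assumes "C \<in> sets (restrict_space borel {0..1})"
  shows "emeasure unit_lebesgue ((farey ^^ n) -` C \<inter> {0..1})
    = (\<integral>\<^sup>+x. indicator C x * ennreal (farey_iterate n x) \<partial>farey_measure)"
proof -
  have C [measurable]: "C \<in> sets borel"
    using assms by (auto simp: sets_restrict_space)
  have [measurable]: "farey ^^ n \<in> borel_measurable borel"
    by (induction n) auto
  have pre: "(farey ^^ n) -` C \<inter> {0..1} \<in> sets borel"
    by measurable
  have "emeasure unit_lebesgue ((farey ^^ n) -` C \<inter> {0..1})
      = (\<integral>\<^sup>+x. ennreal x * indicator ((farey ^^ n) -` C \<inter> {0..1}) x \<partial>farey_measure)"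
    unfolding unit_lebesgue_eq_density
  proof (intro emeasure_density)
    show "ennreal \<in> borel_measurable farey_measure"
      unfolding farey_measure_def unit_lebesgue_def
      by (auto intro: measurable_restrict_space1)
    show "(farey ^^ n) -` C \<inter> {0..1} \<in> sets farey_measure"
      using pre by (auto simp: sets_farey_measure sets_restrict_space image_iff intro!: bexI[of _ "(farey ^^ n) -` C \<inter> {0..1}"])
  qed
  also have "\<dots> = (\<integral>\<^sup>+x. indicator C ((farey ^^ n) x) * ennreal x \<partial>farey_measure)"
  proof (intro nn_integral_cong)
    fix x assume "x \<in> space farey_measure"
    then have "x \<in> {0..1}"
      by (simp add: farey_measure_def unit_lebesgue_def space_restrict_space)
    then show "ennreal x * indicator ((farey ^^ n) -` C \<inter> {0..1}) x
        = indicator C ((farey ^^ n) x) * ennreal x"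
      by (auto split: split_indicator)
  qed
  finally show ?thesis
    by (simp add: nn_integral_farey_iterate)
qed

section \<open>Invariance of increasing concave functions\<close>

lemma concave_on_compose_mono:
  fixes G u :: "real \<Rightarrow> real"
  assumes "concave_on T G" "mono_on T G" "concave_on S u" "u ` S \<subseteq> T"
  shows "concave_on S (\<lambda>x. G (u x))"
  unfolding concave_on_iff
proof (intro conjI ballI allI impI)
  show "convex S" using assms(3) by (rule concave_on_imp_convex)
  fix x y a b :: real
  assume *: "x \<in> S" "y \<in> S" "0 \<le> a" "0 \<le> b" "a + b = 1"
  have T: "u x \<in> T" "u y \<in> T" using * assms(4) by auto
  have "a *\<^sub>R x + b *\<^sub>R y \<in> S"
    using \<open>convex S\<close> * by (auto simp: convex_def)
  moreover have "a *\<^sub>R u x + b *\<^sub>R u y \<in> T"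
    using concave_on_imp_convex[OF assms(1)] T * by (auto simp: convex_def)
  moreover have "a * u x + b * u y \<le> u (a *\<^sub>R x + b *\<^sub>R y)"
    using assms(3) * by (auto simp: concave_on_iff)
  ultimately have "G (a *\<^sub>R u x + b *\<^sub>R u y) \<le> G (u (a *\<^sub>R x + b *\<^sub>R y))"
    using assms(4) by (intro mono_onD[OF assms(2)]) auto
  moreover have "a * G (u x) + b * G (u y) \<le> G (a *\<^sub>R u x + b *\<^sub>R u y)"
    using assms(1) T * by (auto simp: concave_on_iff)
  ultimately show "a * G (u x) + b * G (u y) \<le> G (u (a *\<^sub>R x + b *\<^sub>R y))" by simp
qed

lemma concave_on_reflect:
  fixes g :: "real \<Rightarrow> real"
  assumes "concave_on T g" "convex S" "(\<lambda>x. 1 - x) ` S \<subseteq> T"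
  shows "concave_on S (\<lambda>x. g (1 - x))"
  unfolding concave_on_iff
proof (intro conjI ballI allI impI)
  fix x y a b :: real
  assume *: "x \<in> S" "y \<in> S" "0 \<le> a" "0 \<le> b" "a + b = 1"
  have "1 - (a *\<^sub>R x + b *\<^sub>R y) = a *\<^sub>R (1 - x) + b *\<^sub>R (1 - y)"
    using *(5) by (simp add: algebra_simps)
  moreover have "1 - x \<in> T" "1 - y \<in> T" using * assms(3) by auto
  ultimately show "a * g (1 - x) + b * g (1 - y) \<le> g (1 - (a *\<^sub>R x + b *\<^sub>R y))"
    using assms(1) * unfolding concave_on_iff by metis
qed fact

text \<open>
  Of two intervals of equal length, a concave function grows more over the left one:
  both inner points \<open>b\<close> and \<open>c\<close> are convex combinations of \<open>a\<close> and \<open>d\<close>, with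
  interchanged weights.
\<close>
lemma concave_on_increments:
  fixes g :: "real \<Rightarrow> real"
  assumes g: "concave_on S g" and S: "a \<in> S" "d \<in> S"
    and le: "a < b" "b \<le> c" and eq: "b - a = d - c"
  shows "g d - g c \<le> g b - g a"
proof -
  define t where "t = (b - a) / (d - a)"
  have t: "0 \<le> t" "t \<le> 1" and td: "t * (d - a) = b - a"
    using le eq by (auto simp: t_def)
  have "(1 - t) *\<^sub>R a + t *\<^sub>R d = b" "(1 - (1 - t)) *\<^sub>R a + (1 - t) *\<^sub>R d = c"
    using td eq by (auto simp: algebra_simps)
  then have "(1 - t) * g a + t * g d \<le> g b" "t * g a + (1 - t) * g d \<le> g c"
    using concave_onD[OF g, of t a d] concave_onD[OF g, of "1 - t" a d] t S by auto
  then show ?thesis by (simp add: algebra_simps)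
qed

definition concave_profile :: "(real \<Rightarrow> real) \<Rightarrow> bool" where
  "concave_profile g \<longleftrightarrow>
    concave_on {0..1} g \<and> mono_on {0..1} g \<and> (\<forall>x\<in>{0..1}. 0 \<le> g x)"

text \<open>
  In the variable \<open>u = x / (1 + x)\<close>, which increases from \<open>0\<close> to \<open>1/2\<close>, the operator has
  a simpler form; the next two lemmas treat it in this variable.
\<close>
lemma farey_dual_eq:
  assumes "0 \<le> x"
  shows "farey_dual g x = (1 - x / (1 + x)) * g (x / (1 + x)) + x / (1 + x) * g (1 - x / (1 + x))"
proof -
  have "1 - x / (1 + x) = 1 / (1 + x)" using assms by (simp add: field_simps)
  then show ?thesis by (simp add: farey_dual_def)
qed

text \<open>
  As \<open>u\<close> grows towards \<open>1/2\<close>, weight moves from the smaller value \<open>g u\<close> to the larger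
  value \<open>g (1 - u)\<close>, which increases the mixture. At the same time \<open>g u\<close> grows and
  \<open>g (1 - u)\<close> falls, but by concavity \<open>g\<close> varies more near \<open>u\<close> than near \<open>1 - u\<close>, and
  the weight \<open>1 - u\<close> of the growing term is the larger one. Without concavity the fall
  can win, for example for \<open>g x = x ^ N\<close> with large \<open>N\<close>.
\<close>
lemma mono_on_mixture:
  fixes g :: "real \<Rightarrow> real"
  assumes "concave_profile g"
  shows "mono_on {0..1/2} (\<lambda>u. (1 - u) * g u + u * g (1 - u))"
proof (intro mono_onI)
  fix u v :: real
  assume uv: "u \<in> {0..1/2}" "v \<in> {0..1/2}" "u \<le> v"
  have c: "concave_on {0..1} g" and m: "mono_on {0..1} g"
    using assms by (auto simp: concave_profile_def)
  show "(1 - u) * g u + u * g (1 - u) \<le> (1 - v) * g v + v * g (1 - v)"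
  proof (cases "u = v")
    case False
    have "0 \<le> g (1 - v) - g v"
      using mono_onD[OF m, of v "1 - v"] uv by auto
    then have "0 \<le> (v - u) * (g (1 - v) - g v)" using uv by simp
    moreover have inc: "g (1 - u) - g (1 - v) \<le> g v - g u"
      using concave_on_increments[OF c, of u "1 - u" v "1 - v"] uv False by auto
    have "0 \<le> g (1 - u) - g (1 - v)"
      using mono_onD[OF m, of "1 - v" "1 - u"] uv by auto
    then have "u * (g (1 - u) - g (1 - v)) \<le> (1 - u) * (g v - g u)"
      using uv inc by (intro mult_mono) auto
    ultimately show ?thesis by (simp add: algebra_simps)
  qed simp
qed

text \<open>
  Each summand is a product of two nonnegative concave functions, one increasing and
  the other decreasing; such products are concave.
\<close>
lemma concave_on_mixture:
  fixes g :: "real \<Rightarrow> real"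
  assumes "concave_profile g"
  shows "concave_on {0..1/2} (\<lambda>u. (1 - u) * g u + u * g (1 - u))"
proof -
  have c: "concave_on {0..1} g" and m: "mono_on {0..1} g" and n: "\<And>x. x \<in> {0..1} \<Longrightarrow> 0 \<le> g x"
    using assms by (auto simp: concave_profile_def)
  have "concave_on {0..1/2} (\<lambda>u. g u * (1 - u))"
  proof (rule concave_on_mul)
    show "concave_on {0..1/2} g"
      using c unfolding concave_on_def by (rule convex_on_subset) auto
    show "concave_on {0..1/2::real} (\<lambda>u. 1 - u)"
      by (intro concave_on_diff) (auto simp: concave_on_const convex_on_ident)
    show "mono_on {0..1/2} g"
      using m by (rule mono_on_subset) auto
  qed (auto simp: n intro!: monotone_onI)
  moreover have "concave_on {0..1/2} (\<lambda>u. u * g (1 - u))"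
  proof (rule concave_on_mul)
    show "concave_on {0..1/2} (\<lambda>u. g (1 - u))"
      using c by (rule concave_on_reflect) auto
    show "antimono_on {0..1/2} (\<lambda>u. g (1 - u))"
      by (intro monotone_onI mono_onD[OF m]) auto
  qed (auto simp: n concave_on_ident intro!: monotone_onI)
  ultimately show ?thesis
    using concave_on_add by (fastforce simp: mult.commute)
qed

text \<open>
  The image of \<open>g\<close> is the increasing concave mixture composed with \<open>x / (1 + x)\<close>, which
  is itself increasing and concave; such a composition is again increasing and concave.
\<close>
lemma concave_profile_farey_dual:
  assumes "concave_profile g"
  shows "concave_profile (farey_dual g)"
proof -
  define u :: "real \<Rightarrow> real" where "u x = x / (1 + x)" for x
  define G where "G v = (1 - v) * g v + v * g (1 - v)" for v
  have eq: "farey_dual g x = G (u x)" if "x \<in> {0..1}" for x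
    using that by (simp add: farey_dual_eq G_def u_def)
  have range: "u ` {0..1} \<subseteq> {0..1/2}"
    by (auto simp: u_def divide_simps)
  have mono_u: "mono_on {0..1} u"
    by (auto intro!: mono_onI simp: u_def field_simps)
  have conc_u: "concave_on {0..1} u"
    unfolding u_def
  proof (rule f''_le0_imp_concave)
    fix x :: real assume x: "x \<in> {0..1}"
    show "((\<lambda>x. x / (1 + x)) has_real_derivative 1 / (1 + x)\<^sup>2) (at x)"
      using x by (auto intro!: derivative_eq_intros simp: power2_eq_square divide_simps)
    show "((\<lambda>x. 1 / (1 + x)\<^sup>2) has_real_derivative - 2 / (1 + x) ^ 3) (at x)"
      using x by (auto intro!: derivative_eq_intros simp: power2_eq_square power3_eq_cube divide_simps)
    show "- 2 / (1 + x) ^ 3 \<le> 0" using x by simp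
  qed simp
  have mono_G: "mono_on {0..1/2} G"
    using mono_on_mixture[OF assms] by (simp add: G_def [abs_def])
  have conc_G: "concave_on {0..1/2} G"
    using concave_on_mixture[OF assms] by (simp add: G_def [abs_def])
  have comp: "concave_on {0..1} (\<lambda>x. G (u x))"
    using conc_G mono_G conc_u range by (rule concave_on_compose_mono)
  have "concave_on {0..1} (farey_dual g)"
  proof (intro concave_on_linorderI)
    fix t x y :: real
    assume t: "0 < t" "t < 1" and xy: "x \<in> {0..1}" "y \<in> {0..1}"
    then have "(1 - t) *\<^sub>R x + t *\<^sub>R y \<in> {0..1}"
      by (intro convexD_alt) auto
    then show "(1 - t) * farey_dual g x + t * farey_dual g y
        \<le> farey_dual g ((1 - t) *\<^sub>R x + t *\<^sub>R y)"
      using concave_onD[OF comp, of t x y] t xy by (simp add: eq)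
  qed simp
  moreover have "(\<forall>x\<in>{0..1}. 0 \<le> farey_dual g x)"
    using assms farey_dual_nonneg by (auto simp: concave_profile_def)
  moreover have "mono_on {0..1} (farey_dual g)"
  proof (intro mono_onI)
    fix x y :: real assume xy: "x \<in> {0..1}" "y \<in> {0..1}" "x \<le> y"
    then have "u x \<le> u y" by (intro mono_onD[OF mono_u])
    moreover have "u x \<in> {0..1/2}" "u y \<in> {0..1/2}"
      using range xy(1,2) by blast+
    ultimately have "G (u x) \<le> G (u y)" by (intro mono_onD[OF mono_G])
    then show "farey_dual g x \<le> farey_dual g y" using xy by (simp add: eq)
  qed
  ultimately show ?thesis by (simp add: concave_profile_def)
qed

lemma concave_profile_farey_iterate: "concave_profile (farey_iterate n)"
proof (induction n)
  case 0
  show ?case by (auto simp: concave_profile_def concave_on_ident intro: mono_onI)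
next
  case (Suc n)
  then show ?case by (simp add: concave_profile_farey_dual)
qed

section \<open>Uniform decay of the densities\<close>

lemma farey_iterate_le_at_1: "x \<in> {0..1} \<Longrightarrow> farey_iterate n x \<le> farey_iterate n 1"
  using concave_profile_farey_iterate[of n]
  by (auto simp: concave_profile_def intro: mono_onD[of "{0..1}"])

lemma farey_iterate_Suc_at_1: "farey_iterate (Suc n) 1 = farey_iterate n (1/2)"
  by (simp add: farey_dual_def)

text \<open>
  The Farey map sends both \<open>1 / (k + 2)\<close> and \<open>(k + 1) / (k + 2)\<close> to \<open>1 / (k + 1)\<close>.
  Bounding the value at the second preimage by the value at \<open>1\<close> and solving the
  recursion at \<open>1 / (k + 1)\<close> for the value at the first preimage yields a lower bound
  that also converges to \<open>a\<close>.
\<close>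
lemma farey_iterate_tendsto_at_unit_fraction:
  assumes "(\<lambda>n. farey_iterate n 1) \<longlonglongrightarrow> a"
  shows "(\<lambda>n. farey_iterate n (1 / real (Suc k))) \<longlonglongrightarrow> a"
proof (induction k)
  case 0
  then show ?case using assms by simp
next
  case (Suc k)
  let ?K = "real (Suc k)"
  define lower where
    "lower n = ((?K + 1) * farey_iterate (Suc n) (1 / ?K) - farey_iterate n 1) / ?K" for n
  have "(\<lambda>n. farey_iterate (Suc n) (1 / ?K)) \<longlonglongrightarrow> a"
    using Suc by (rule LIMSEQ_Suc)
  then have "lower \<longlonglongrightarrow> ((?K + 1) * a - a) / ?K"
    unfolding lower_def using assms by (rule tendsto_divide[OF tendsto_diff[OF tendsto_mult_left] tendsto_const]) simp
  moreover have "((?K + 1) * a - a) / ?K = a" by (simp add: field_simps)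
  ultimately have "lower \<longlonglongrightarrow> a" by (simp only:)
  have lower: "lower n \<le> farey_iterate n (1 / real (Suc (Suc k)))" for n
  proof -
    have "farey_iterate (Suc n) (1 / ?K) = ?K / (?K + 1) * farey_iterate n (1 / (?K + 1))
        + 1 / (?K + 1) * farey_iterate n (?K / (?K + 1))"
    proof -
      have "1 / (1 + 1 / ?K) = ?K / (?K + 1)" "1 / ?K / (1 + 1 / ?K) = 1 / (?K + 1)"
        by (simp_all add: field_simps)
      then show ?thesis by (simp only: funpow.simps o_apply farey_dual_def)
    qed
    then have "(?K + 1) * farey_iterate (Suc n) (1 / ?K)
        = ?K * farey_iterate n (1 / (?K + 1)) + farey_iterate n (?K / (?K + 1))"
      by (simp only: distrib_left) simp
    moreover have "farey_iterate n (?K / (?K + 1)) \<le> farey_iterate n 1"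
      by (rule farey_iterate_le_at_1) auto
    ultimately have "(?K + 1) * farey_iterate (Suc n) (1 / ?K) - farey_iterate n 1
        \<le> farey_iterate n (1 / real (Suc (Suc k))) * ?K"
      by (simp add: algebra_simps)
    then show ?thesis
      unfolding lower_def by (subst pos_divide_le_eq) auto
  qed
  have upper: "farey_iterate n (1 / real (Suc (Suc k))) \<le> farey_iterate n 1" for n
    by (rule farey_iterate_le_at_1) auto
  show ?case
    using \<open>lower \<longlonglongrightarrow> a\<close> assms
    by (rule tendsto_sandwich[rotated 2]) (intro always_eventually allI lower upper)+
qed

text \<open>
  The left-hand side is a lower bound for the integral of the iterate with respect to
  \<open>dx / x\<close> over the interval from \<open>1 / k\<close> to \<open>1\<close>, and the integral over the whole unit
  interval is the total Lebesgue mass \<open>1\<close> by duality.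
\<close>
lemma farey_iterate_log_bound:
  assumes "0 < k"
  shows "farey_iterate n (1 / real k) * ln (real k) \<le> 1"
proof -
  let ?e = "1 / real k"
  let ?g = "farey_iterate n ?e"
  have e: "0 < ?e" "?e \<le> 1" using assms by auto
  have g0: "0 \<le> ?g" using e by (intro farey_iterate_nonneg) auto
  have "(\<integral>\<^sup>+x. ennreal (1 / x) * indicator {?e..1} x \<partial>lborel) = ennreal (ln 1 - ln ?e)"
  proof (rule nn_integral_FTC_Icc)
    fix x assume "x \<in> {?e..1}"
    then have "?e \<le> x" by simp
    with e(1) have "0 < x" by (rule order.strict_trans2)
    then show "(ln has_real_derivative 1 / x) (at x)"
      by (auto intro!: derivative_eq_intros)
    show "0 \<le> 1 / x" using \<open>0 < x\<close> by simp
  qed (use e in auto)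
  then have log: "(\<integral>\<^sup>+x. ennreal (1 / x) * indicator {?e..1} x \<partial>lborel) = ennreal (ln (real k))"
    using assms by (simp add: ln_div)
  have "ennreal (?g * ln (real k))
      = (\<integral>\<^sup>+x. ennreal ?g * (ennreal (1 / x) * indicator {?e..1} x) \<partial>lborel)"
    using g0 assms by (subst nn_integral_cmult) (auto simp: log ennreal_mult')
  also have "\<dots> \<le> (\<integral>\<^sup>+x. 1 * ennreal (farey_iterate n x) * ennreal (1 / x) * indicator {0..1} x \<partial>lborel)"
  proof (intro nn_integral_mono)
    fix x :: real
    have unit: "x \<in> {0..1}" if "x \<in> {?e..1}"
      using that order.trans[OF less_imp_le[OF e(1)], of x] by simp
    have "?g \<le> farey_iterate n x" if "x \<in> {?e..1}"
    proof (rule mono_onD[where f = "farey_iterate n" and A = "{0..1}"])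
      show "mono_on {0..1} (farey_iterate n)"
        using concave_profile_farey_iterate by (simp add: concave_profile_def)
    qed (use e that unit in auto)
    with unit show "ennreal ?g * (ennreal (1 / x) * indicator {?e..1} x)
        \<le> 1 * ennreal (farey_iterate n x) * ennreal (1 / x) * indicator {0..1} x"
      by (cases "x \<in> {?e..1}") (auto intro!: mult_right_mono ennreal_leI)
  qed
  also have "\<dots> = (\<integral>\<^sup>+x. 1 * ennreal (farey_iterate n x) \<partial>farey_measure)"
    by (rule nn_integral_farey_measure [symmetric]) auto
  also have "\<dots> = (\<integral>\<^sup>+x. 1 * ennreal x \<partial>farey_measure)"
    by (rule nn_integral_farey_iterate [symmetric]) auto
  also have "\<dots> = (\<integral>\<^sup>+x. 1 * ennreal x * ennreal (1 / x) * indicator {0..1} x \<partial>lborel)"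
    by (rule nn_integral_farey_measure) auto
  also have "\<dots> \<le> (\<integral>\<^sup>+x. indicator {0..1::real} x \<partial>lborel)"
    by (intro nn_integral_mono) (auto split: split_indicator simp flip: ennreal_mult)
  also have "\<dots> = ennreal 1" by simp
  finally show ?thesis by simp
qed

lemma farey_iterate_at_1_tendsto_0: "(\<lambda>n. farey_iterate n 1) \<longlonglongrightarrow> 0"
proof -
  have nonneg: "0 \<le> farey_iterate n 1" for n
    by (rule farey_iterate_nonneg) simp
  have "farey_iterate (Suc n) 1 \<le> farey_iterate n 1" for n
    unfolding farey_iterate_Suc_at_1 by (rule farey_iterate_le_at_1) simp
  then have "decseq (\<lambda>n. farey_iterate n 1)"
    by (rule decseq_SucI)
  then obtain a where a: "(\<lambda>n. farey_iterate n 1) \<longlonglongrightarrow> a"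
    by (rule decseq_convergent[where B = 0]) (simp_all add: nonneg)
  have "0 \<le> a"
    by (rule LIMSEQ_le_const[OF a]) (simp add: nonneg)
  have bound: "a * ln (real (Suc k)) \<le> 1" for k
  proof (rule LIMSEQ_le_const2)
    show "(\<lambda>n. farey_iterate n (1 / real (Suc k)) * ln (real (Suc k)))
        \<longlonglongrightarrow> a * ln (real (Suc k))"
      by (intro tendsto_mult_right farey_iterate_tendsto_at_unit_fraction a)
    show "\<exists>N. \<forall>n\<ge>N. farey_iterate n (1 / real (Suc k)) * ln (real (Suc k)) \<le> 1"
      using farey_iterate_log_bound[of "Suc k"] by blast
  qed
  have "a = 0"
  proof (rule ccontr)
    assume "a \<noteq> 0"
    with \<open>0 \<le> a\<close> have "0 < a" by simp
    obtain k where k: "exp (1 / a) < real k" using reals_Archimedean2 by blast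
    have "1 / a < ln (real (Suc k))"
      using ln_less_cancel_iff[of "exp (1 / a)" "real (Suc k)"] k by simp
    then show False using bound[of k] \<open>0 < a\<close> by (simp add: field_simps)
  qed
  with a show ?thesis by simp
qed

theorem proposition3p4:
  fixes C :: "real set"
  assumes "C \<in> sets (restrict_space borel {0..1})"
    and "emeasure farey_measure C < \<infinity>"
  shows "(\<lambda>n. measure unit_lebesgue ((farey ^^ n) -` C \<inter> {0..1})) \<longlonglongrightarrow> 0"
proof -
  have C: "C \<in> sets farey_measure"
    using assms(1) by (simp add: sets_farey_measure)
  have le: "measure unit_lebesgue ((farey ^^ n) -` C \<inter> {0..1})
      \<le> farey_iterate n 1 * measure farey_measure C" for n
  proof -
    have g: "0 \<le> farey_iterate n 1" by (rule farey_iterate_nonneg) simp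
    have "emeasure unit_lebesgue ((farey ^^ n) -` C \<inter> {0..1})
        = (\<integral>\<^sup>+x. indicator C x * ennreal (farey_iterate n x) \<partial>farey_measure)"
      by (rule emeasure_vimage_farey_iterate[OF assms(1)])
    also have "\<dots> \<le> (\<integral>\<^sup>+x. ennreal (farey_iterate n 1) * indicator C x \<partial>farey_measure)"
    proof (intro nn_integral_mono)
      fix x assume "x \<in> space farey_measure"
      then have "x \<in> {0..1}"
        by (simp add: farey_measure_def unit_lebesgue_def space_restrict_space)
      then show "indicator C x * ennreal (farey_iterate n x)
          \<le> ennreal (farey_iterate n 1) * indicator C x"
        by (auto split: split_indicator intro!: ennreal_leI farey_iterate_le_at_1)
    qed
    also have "\<dots> = ennreal (farey_iterate n 1) * emeasure farey_measure C"
      using C by (rule nn_integral_cmult_indicator)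
    also have "\<dots> = ennreal (farey_iterate n 1 * measure farey_measure C)"
      using assms(2) g by (simp add: emeasure_eq_ennreal_measure ennreal_mult)
    finally show ?thesis
      using g by (simp add: measure_def enn2real_leI)
  qed
  have "(\<lambda>n. farey_iterate n 1 * measure farey_measure C) \<longlonglongrightarrow> 0"
    using tendsto_mult_left_zero[OF farey_iterate_at_1_tendsto_0] by simp
  with tendsto_const show ?thesis
    by (rule tendsto_sandwich[rotated 2]) (simp_all add: le)
qed

end
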